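(* The solvability measure is an isomorphism invariant: if $L_1$ and $L_2$ are finite dimensional non-solvable Lie superalgebras over a field $\mathbb{F}$ with $\operatorname{char}\mathbb{F}\geq 3$ and $L_1\cong L_2$, then $\nu(L_1)=\nu(L_2)$.
   Context: All Lie superalgebras are over a fixed field $\mathbb{F}$ (if $\operatorname{char}\mathbb{F}=3$, the axioms also include $[x,[x,x]]=0$ for all odd $x$). "Subalgebra" means subsuperalgebra ($\mathbb{Z}_2$-graded subspace closed under the bracket), and $\langle x,y\rangle$ denotes the subalgebra (subsuperalgebra) generated by the (not necessarily homogeneous) elements $x,y$. Solvable means that the derived series reaches $0$. $\operatorname{sol}(L)=\{x\in L\mid\langle z,x\rangle\text{ is solvable for all }z\in L\}$. For a finite dimensional non-solvable Lie superalgebra $L$, the solvable graph $\mathfrak{S}(L)=(V,E)$ is the simple graph with vertex set $V=L\setminus(\operatorname{sol}(L)\cup\{0\})$ in which distinct $x,y\in V$ are adjacent if and only if $\langle x,y\rangle$ is solvable. For $\operatorname{char}\mathbb{F}\ge 3$ the solvability measure of $L$ is $$\nu(L)=1-\frac{2|E|}{|V|(|V|-1)},$$ where $|E|$ and $|V|$ are the numbers of elements of $E$ and $V$; the formula presupposes that these are finite (as when $\mathbb{F}$ is a finite field). *)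

theory Defs
  imports Complex_Main "HOL-Library.Z2"
begin

text \<open>
  The underlying vector space is the whole type \<^typ>\<open>'a\<close>. The grading is indexed by the two-element
  type \<^typ>\<open>bit\<close>, whose addition and multiplication are those of $\mathbb{Z}_2$;
  \<open>part 0\<close> is the even part and \<open>part 1\<close> the odd part.
\<close>

definition super_sign :: "bit \<Rightarrow> bit \<Rightarrow> 'f::field"
  where "super_sign i j = (if i * j = 1 then - 1 else 1)"

text \<open>
  No axiom special to characteristic 2 is imposed, so the locale is the standard notion of
  Lie superalgebra only for \<open>CHAR('f) \<noteq> 2\<close>.
\<close>

locale lie_superalgebra = vector_space scale
  for scale :: "'f::field \<Rightarrow> 'a::ab_group_add \<Rightarrow> 'a" +
  fixes part :: "bit \<Rightarrow> 'a set"
    and bracket :: "'a \<Rightarrow> 'a \<Rightarrow> 'a"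
  assumes subspace_part: "subspace (part i)"
    and part_disjoint: "part 0 \<inter> part 1 = {0}"
    and part_span: "\<exists>a\<in>part 0. \<exists>b\<in>part 1. x = a + b"
    and linear_bracket_right: "Vector_Spaces.linear scale scale (\<lambda>y. bracket x y)"
    and linear_bracket_left: "Vector_Spaces.linear scale scale (\<lambda>x. bracket x y)"
    and bracket_part: "x \<in> part i \<Longrightarrow> y \<in> part j \<Longrightarrow> bracket x y \<in> part (i + j)"
    and super_skew: "x \<in> part i \<Longrightarrow> y \<in> part j \<Longrightarrow>
      bracket x y = - scale (super_sign i j) (bracket y x)"
    and super_jacobi: "x \<in> part i \<Longrightarrow> y \<in> part j \<Longrightarrow> z \<in> part k \<Longrightarrow>
      bracket x (bracket y z) =
        bracket (bracket x y) z + scale (super_sign i j) (bracket y (bracket x z))"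
    and odd_cube_char_3: "CHAR('f) = 3 \<Longrightarrow> x \<in> part 1 \<Longrightarrow> bracket x (bracket x x) = 0"
begin

definition graded_subspace :: "'a set \<Rightarrow> bool"
  where "graded_subspace S \<longleftrightarrow>
    subspace S \<and> (\<forall>x\<in>S. \<exists>a\<in>S \<inter> part 0. \<exists>b\<in>S \<inter> part 1. x = a + b)"

definition subsuperalgebra :: "'a set \<Rightarrow> bool"
  where "subsuperalgebra S \<longleftrightarrow>
    graded_subspace S \<and> (\<forall>x\<in>S. \<forall>y\<in>S. bracket x y \<in> S)"

definition generated2 :: "'a \<Rightarrow> 'a \<Rightarrow> 'a set"
  where "generated2 x y = subsuperalgebra hull {x, y}"

primrec derived_series :: "nat \<Rightarrow> 'a set \<Rightarrow> 'a set"
  where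
    "derived_series 0 S = S"
  | "derived_series (Suc n) S =
      span {bracket x y | x y. x \<in> derived_series n S \<and> y \<in> derived_series n S}"

definition solvable :: "'a set \<Rightarrow> bool"
  where "solvable S \<longleftrightarrow> (\<exists>n. derived_series n S = {0})"

definition sol :: "'a set"
  where "sol = {x. \<forall>z. solvable (generated2 z x)}"

definition solvable_graph_vertices :: "'a set"
  where "solvable_graph_vertices = UNIV - (sol \<union> {0})"

definition solvable_graph_edges :: "'a set set"
  where "solvable_graph_edges =
    {{x, y} | x y. x \<in> solvable_graph_vertices \<and> y \<in> solvable_graph_vertices \<and>
      x \<noteq> y \<and> solvable (generated2 x y)}"

text \<open>
  This is the solvability measure when the solvable graph is finite, for instance when \<^typ>\<open>'f\<close>
  is finite and the algebra is finite dimensional. For infinitely many vertices the value is the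
  meaningless \<open>1\<close>, since \<^const>\<open>card\<close> of an infinite set is \<open>0\<close> and division by \<open>0\<close> gives \<open>0\<close>.
\<close>

definition solvability_measure :: real
  where "solvability_measure =
    1 - 2 * real (card solvable_graph_edges) /
      (real (card solvable_graph_vertices) * (real (card solvable_graph_vertices) - 1))"

end

definition lie_superalgebra_iso ::
  "('f::field \<Rightarrow> 'a::ab_group_add \<Rightarrow> 'a) \<Rightarrow> (bit \<Rightarrow> 'a set) \<Rightarrow> ('a \<Rightarrow> 'a \<Rightarrow> 'a) \<Rightarrow>
   ('f \<Rightarrow> 'b::ab_group_add \<Rightarrow> 'b) \<Rightarrow> (bit \<Rightarrow> 'b set) \<Rightarrow> ('b \<Rightarrow> 'b \<Rightarrow> 'b) \<Rightarrow> ('a \<Rightarrow> 'b) \<Rightarrow> bool"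
  where "lie_superalgebra_iso scale1 part1 bracket1 scale2 part2 bracket2 f \<longleftrightarrow>
    Vector_Spaces.linear scale1 scale2 f \<and> bij f \<and>
    (\<forall>i. f ` part1 i \<subseteq> part2 i) \<and>
    (\<forall>x y. f (bracket1 x y) = bracket2 (f x) (f y))"

end

theory Submission
  imports Defs
begin

text \<open>
  The solvable graph is built from the grading, the bracket and the linear structure alone, so an
  isomorphism \<open>f\<close> of Lie superalgebras is an isomorphism of solvable graphs, and the measure only
  counts vertices and edges. The one point at which the definition of an isomorphism has to be
  strengthened is the grading: \<open>f\<close> is only required to map homogeneous elements to homogeneous
  elements of the same degree, while transporting a subsuperalgebra back along \<open>f\<close> needs that degrees
  are reflected as well. This follows because the homogeneous components of an element are unique
  (\<open>image_part\<close>). Then subsuperalgebras correspond in both directions, so \<open>f\<close> maps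
  \<open>\<langle>x, y\<rangle>\<close> onto \<open>\<langle>f x, f y\<rangle>\<close> (\<open>image_generated2\<close>), and it commutes with
  derived series (\<open>image_derived_series\<close>), so it preserves and reflects solvability of
  two-generated subalgebras (\<open>solvable_generated2_iff\<close>), which is the only
  input to the vertices and the edges.
\<close>

locale lie_superalgebra_isomorphism =
  L1: lie_superalgebra scale1 part1 bracket1 + L2: lie_superalgebra scale2 part2 bracket2
  for scale1 :: "'f::field \<Rightarrow> 'a::ab_group_add \<Rightarrow> 'a" and part1 bracket1
    and scale2 :: "'f \<Rightarrow> 'b::ab_group_add \<Rightarrow> 'b" and part2 bracket2 +
  fixes f :: "'a \<Rightarrow> 'b"
  assumes iso: "lie_superalgebra_iso scale1 part1 bracket1 scale2 part2 bracket2 f"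
begin

sublocale Vector_Spaces.linear scale1 scale2 f
  using iso by (simp add: lie_superalgebra_iso_def)

lemma bij: "bij f"
  and part: "x \<in> part1 i \<Longrightarrow> f x \<in> part2 i"
  and bracket: "f (bracket1 x y) = bracket2 (f x) (f y)"
  using iso by (auto simp: lie_superalgebra_iso_def)

lemma inj: "inj f"
  using bij by (rule bij_is_inj)

lemma surj: "surj f"
  using bij by (rule bij_is_surj)

text \<open>
  Only \<open>\<subseteq>\<close> is part of the definition of an isomorphism. Conversely, if \<open>f x\<close> is homogeneous of
  degree \<open>i\<close>, then the component of \<open>x\<close> in the other degree is mapped into both parts of the
  codomain, hence to \<open>0\<close>.
\<close>

lemma image_part: "f ` part1 i = part2 i"
proof
  show "f ` part1 i \<subseteq> part2 i"
    by (auto intro: part)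
  show "part2 i \<subseteq> f ` part1 i"
  proof
    fix y assume y: "y \<in> part2 i"
    obtain x where x: "y = f x"
      using surj by blast
    obtain a b where "a \<in> part1 0" "b \<in> part1 1" "x = a + b"
      using L1.part_span by blast
    then obtain a b where ab: "a \<in> part1 i" "b \<in> part1 (i + 1)" "x = a + b"
      by (cases i) (auto simp: add.commute)
    have "f b = y - f a"
      by (simp add: x ab(3) add)
    then have "f b \<in> part2 i"
      using y part[OF ab(1)] L2.subspace_diff[OF L2.subspace_part] by simp
    moreover have "f b \<in> part2 (i + 1)"
      using ab(2) by (rule part)
    ultimately have "f b = 0"
      using L2.part_disjoint by (cases i) auto
    then have "y = f a"
      by (simp add: x ab(3) add)
    then show "y \<in> f ` part1 i"
      using ab(1) by blast
  qed
qed

lemma part_iff: "f x \<in> part2 i \<longleftrightarrow> x \<in> part1 i"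
  using image_part inj by (metis inj_image_mem_iff)

lemma subsuperalgebra_image:
  assumes "L1.subsuperalgebra S"
  shows "L2.subsuperalgebra (f ` S)"
proof -
  have S: "L1.subspace S" "\<forall>x\<in>S. \<exists>a\<in>S \<inter> part1 0. \<exists>b\<in>S \<inter> part1 1. x = a + b"
    "\<forall>x\<in>S. \<forall>y\<in>S. bracket1 x y \<in> S"
    using assms by (auto simp: L1.subsuperalgebra_def L1.graded_subspace_def)
  have "\<exists>a\<in>f ` S \<inter> part2 0. \<exists>b\<in>f ` S \<inter> part2 1. f x = a + b" if x: "x \<in> S" for x
  proof -
    obtain a b where "a \<in> S \<inter> part1 0" "b \<in> S \<inter> part1 1" "x = a + b"
      using S(2) x by blast
    then show ?thesis
      by (intro bexI[of _ "f a"] bexI[of _ "f b"]) (auto simp: add part)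
  qed
  then show ?thesis
    using S(1,3) subspace_image[OF S(1)]
    by (auto simp: L2.subsuperalgebra_def L2.graded_subspace_def simp flip: bracket)
qed

lemma subsuperalgebra_vimage:
  assumes "L2.subsuperalgebra T"
  shows "L1.subsuperalgebra (f -` T)"
proof -
  have T: "L2.subspace T" "\<forall>y\<in>T. \<exists>a\<in>T \<inter> part2 0. \<exists>b\<in>T \<inter> part2 1. y = a + b"
    "\<forall>x\<in>T. \<forall>y\<in>T. bracket2 x y \<in> T"
    using assms by (auto simp: L2.subsuperalgebra_def L2.graded_subspace_def)
  have "\<exists>a\<in>f -` T \<inter> part1 0. \<exists>b\<in>f -` T \<inter> part1 1. x = a + b" if x: "f x \<in> T" for x
  proof -
    obtain a' b' where ab': "a' \<in> T \<inter> part2 0" "b' \<in> T \<inter> part2 1" "f x = a' + b'"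
      using T(2) x by blast
    obtain a b where ab: "a' = f a" "b' = f b"
      using surj by blast
    have "f x = f (a + b)"
      by (simp only: ab'(3) ab add)
    then have "x = a + b"
      using inj by (rule injD[rotated])
    then show ?thesis
      using ab' by (intro bexI[of _ a] bexI[of _ b]) (auto simp: ab part_iff)
  qed
  then show ?thesis
    using T(3) subspace_vimage[OF T(1)]
    by (auto simp: L1.subsuperalgebra_def L1.graded_subspace_def bracket)
qed

lemma image_generated2: "f ` L1.generated2 x y = L2.generated2 (f x) (f y)"
proof
  have "L1.generated2 x y \<subseteq> f -` T" if "L2.subsuperalgebra T" "{f x, f y} \<subseteq> T" for T
    unfolding L1.generated2_def
    using that by (intro hull_minimal subsuperalgebra_vimage) auto
  then show "f ` L1.generated2 x y \<subseteq> L2.generated2 (f x) (f y)"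
    unfolding L2.generated2_def hull_def by blast
  have "L2.generated2 (f x) (f y) \<subseteq> f ` S" if "L1.subsuperalgebra S" "{x, y} \<subseteq> S" for S
    unfolding L2.generated2_def
    using that by (intro hull_minimal subsuperalgebra_image) auto
  \<comment> \<open>Injectivity lets one preimage \<open>w\<close> lie in all competing \<open>S\<close> at once.\<close>
  then have S: "w \<in> S"
    if "f w \<in> L2.generated2 (f x) (f y)" "L1.subsuperalgebra S" "{x, y} \<subseteq> S" for w S
    using that inj_image_mem_iff[OF inj] by blast
  show "L2.generated2 (f x) (f y) \<subseteq> f ` L1.generated2 x y"
  proof
    fix z assume z: "z \<in> L2.generated2 (f x) (f y)"
    obtain w where w: "z = f w"
      using surj by blast
    have "w \<in> L1.generated2 x y"
      using S z unfolding L1.generated2_def hull_def w by blast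
    then show "z \<in> f ` L1.generated2 x y"
      by (simp add: w)
  qed
qed

lemma image_derived_series: "f ` L1.derived_series n S = L2.derived_series n (f ` S)"
proof (induction n)
  case (Suc n)
  have "f ` {bracket1 x y | x y. x \<in> L1.derived_series n S \<and> y \<in> L1.derived_series n S} =
      {bracket2 x y | x y. x \<in> f ` L1.derived_series n S \<and> y \<in> f ` L1.derived_series n S}"
    by (force simp: bracket)
  then show ?case
    unfolding L1.derived_series.simps L2.derived_series.simps Suc.IH[symmetric]
    by (metis span_image)
qed simp

lemma solvable_image_iff: "L2.solvable (f ` S) \<longleftrightarrow> L1.solvable S"
proof -
  have "f ` L1.derived_series n S = {0} \<longleftrightarrow> L1.derived_series n S = {0}" for n
    using inj_image_eq_iff[OF inj, of _ "{0}"] by (simp add: zero)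
  then show ?thesis
    by (simp add: L1.solvable_def L2.solvable_def flip: image_derived_series)
qed

lemma solvable_generated2_iff:
  "L2.solvable (L2.generated2 (f x) (f y)) \<longleftrightarrow> L1.solvable (L1.generated2 x y)"
  by (simp add: solvable_image_iff flip: image_generated2)

text \<open>Surjectivity matters here: every test element \<open>z\<close> of the codomain is an \<open>f w\<close>.\<close>

lemma sol_iff: "f x \<in> L2.sol \<longleftrightarrow> x \<in> L1.sol"
proof -
  have "f x \<in> L2.sol \<longleftrightarrow> (\<forall>w. L2.solvable (L2.generated2 (f w) (f x)))"
    unfolding L2.sol_def mem_Collect_eq
  proof (intro iffI allI)
    fix z assume "\<forall>w. L2.solvable (L2.generated2 (f w) (f x))"
    moreover obtain w where "z = f w"
      using surj by blast
    ultimately show "L2.solvable (L2.generated2 z (f x))"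
      by simp
  qed simp
  then show ?thesis
    by (simp add: L1.sol_def solvable_generated2_iff)
qed

lemma vertices_iff: "f x \<in> L2.solvable_graph_vertices \<longleftrightarrow> x \<in> L1.solvable_graph_vertices"
  using inj_eq[OF inj, of x 0]
  by (simp add: L1.solvable_graph_vertices_def L2.solvable_graph_vertices_def sol_iff zero)

lemma image_vertices: "f ` L1.solvable_graph_vertices = L2.solvable_graph_vertices"
proof -
  have "L1.solvable_graph_vertices = f -` L2.solvable_graph_vertices"
    by (simp add: vimage_def vertices_iff)
  then show ?thesis
    using surj by (simp add: surj_image_vimage_eq)
qed

lemma image_edges: "(`) f ` L1.solvable_graph_edges = L2.solvable_graph_edges"
proof
  show "(`) f ` L1.solvable_graph_edges \<subseteq> L2.solvable_graph_edges"
  proof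
    fix e' assume "e' \<in> (`) f ` L1.solvable_graph_edges"
    then obtain x y where e: "e' = {f x, f y}" "x \<in> L1.solvable_graph_vertices"
      "y \<in> L1.solvable_graph_vertices" "x \<noteq> y" "L1.solvable (L1.generated2 x y)"
      by (auto simp: L1.solvable_graph_edges_def)
    have "f x \<noteq> f y"
      using e(4) inj by (simp add: inj_eq)
    with e show "e' \<in> L2.solvable_graph_edges"
      unfolding L2.solvable_graph_edges_def
      by (intro CollectI exI[of _ "f x"] exI[of _ "f y"])
        (simp add: vertices_iff solvable_generated2_iff)
  qed
  show "L2.solvable_graph_edges \<subseteq> (`) f ` L1.solvable_graph_edges"
  proof
    fix e assume "e \<in> L2.solvable_graph_edges"
    then obtain x' y' where e: "e = {x', y'}" "x' \<in> L2.solvable_graph_vertices"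
      "y' \<in> L2.solvable_graph_vertices" "x' \<noteq> y'" "L2.solvable (L2.generated2 x' y')"
      by (auto simp: L2.solvable_graph_edges_def)
    obtain x y where xy: "x' = f x" "y' = f y"
      using surj by blast
    have "{x, y} \<in> L1.solvable_graph_edges"
      using e by (auto simp: L1.solvable_graph_edges_def xy vertices_iff solvable_generated2_iff)
    then show "e \<in> (`) f ` L1.solvable_graph_edges"
      by (rule rev_image_eqI) (simp add: e xy)
  qed
qed

text \<open>
  Injectivity gives equal cardinalities, also for infinite graphs, where both sides take the same
  default value.
\<close>

lemma solvability_measure_eq: "L1.solvability_measure = L2.solvability_measure"
proof -
  have "card L2.solvable_graph_vertices = card L1.solvable_graph_vertices"
    unfolding image_vertices[symmetric] by (intro card_image inj_on_subset[OF inj]) simp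
  moreover have "card L2.solvable_graph_edges = card L1.solvable_graph_edges"
    unfolding image_edges[symmetric]
    by (intro card_image inj_onI) (simp add: inj_image_eq_iff[OF inj])
  ultimately show ?thesis
    by (simp add: L1.solvability_measure_def L2.solvability_measure_def)
qed

end

theorem corollary16:
  fixes scale1 :: "'f::field \<Rightarrow> 'a::ab_group_add \<Rightarrow> 'a"
    and part1 :: "bit \<Rightarrow> 'a set"
    and bracket1 :: "'a \<Rightarrow> 'a \<Rightarrow> 'a"
    and scale2 :: "'f \<Rightarrow> 'b::ab_group_add \<Rightarrow> 'b"
    and part2 :: "bit \<Rightarrow> 'b set"
    and bracket2 :: "'b \<Rightarrow> 'b \<Rightarrow> 'b"
  assumes "CHAR('f) \<ge> 3"
    and "lie_superalgebra scale1 part1 bracket1"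
    and "lie_superalgebra scale2 part2 bracket2"
    and "\<exists>B. finite_dimensional_vector_space scale1 B"
    and "\<exists>B. finite_dimensional_vector_space scale2 B"
    and "\<not> lie_superalgebra.solvable scale1 bracket1 UNIV"
    and "\<not> lie_superalgebra.solvable scale2 bracket2 UNIV"
    and "\<exists>f. lie_superalgebra_iso scale1 part1 bracket1 scale2 part2 bracket2 f"
  shows "lie_superalgebra.solvability_measure scale1 part1 bracket1
    = lie_superalgebra.solvability_measure scale2 part2 bracket2"
proof -
  obtain f where f: "lie_superalgebra_iso scale1 part1 bracket1 scale2 part2 bracket2 f"
    using assms(8) by blast
  interpret lie_superalgebra_isomorphism scale1 part1 bracket1 scale2 part2 bracket2 f
    using assms(2,3) f
    by (simp add: lie_superalgebra_isomorphism_def lie_superalgebra_isomorphism_axioms_def)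
  show ?thesis
    by (rule solvability_measure_eq)
qed

end
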